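(* Let $(p_s,\Phi_s)$, $t\le s\le T$, be a classical solution of the discrete mean field game system $$\frac{dp_s(i)}{ds}+\sum_{j\in\mathcal N_i}\sqrt{\omega_{ij}}\,\theta_{ij}(p_s)H'_{ij}\big((\overline\nabla_\omega\Phi_s)_{i,j}\big)=0,\qquad \frac{d\Phi_s(i)}{ds}+\sum_{j\in\mathcal N_i}H_{ij}\big((\overline\nabla_\omega\Phi_s)_{i,j}\big)\frac{\partial\theta_{ij}(p_s)}{\partial p_i}+F_i(p_s)=0,\quad t\le s\le T,$$ $$p_t(i)=p_i,\qquad \Phi_T(i)=G_i(p_T),\qquad i=1,\dots,n.$$ Let $u(p,t)=(u_i(p,t))_{i=1}^n$ be a classical solution of the master equation $$\frac{\partial}{\partial t}u_i(p,t)+\sum_{j\in\mathcal N_i}H_{ij}\big((\overline\nabla_\omega u(p,t))_{i,j}\big)\frac{\partial}{\partial p_i}\theta_{ij}(p)+F_i(p)+\frac12\sum_{(j,k)\in E}H'_{jk}\big((\overline\nabla_\omega u(p,t))_{j,k}\big)(\overline\nabla_\omega\nabla_pu_i(p,t))_{j,k}\theta_{jk}(p)=0,\quad t\le T,$$ $$u_i(p,T)=G_i(p).$$ Then $$\Phi_s(i)=u_i(p_s,s),\qquad t\le s\le T,\quad i=1,\dots,n.$$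
   Context: $\mathcal X=\{1,\dots,n\}$ and $\mathcal P(\mathcal X)=\{p\in\mathbb R^n:\ p_i\ge0,\ \sum_ip_i=1\}$. $Q$ is the generator of a reversible continuous-time Markov chain on $\mathcal X$ ($Q_{ij}\ge0$ for $j\ne i$, zero row sums) with unique positive invariant measure $\pi$ satisfying $Q_{ij}\pi_i=Q_{ji}\pi_j$. Put $\omega_{ij}=Q_{ij}\pi_i$, $E=\{(i,j):i\ne j,\ \omega_{ij}>0\}$, $\mathcal N_i=\{j:(i,j)\in E\}$. Notation: $(\overline\nabla_\omega\Phi)_{i,j}=\sqrt{\omega_{ij}}(\Phi_j-\Phi_i)$ and $(\overline\nabla_\omega\nabla_pu_i)_{j,k}=\sqrt{\omega_{jk}}\big(\frac{\partial u_i}{\partial p_k}-\frac{\partial u_i}{\partial p_j}\big)$. The activation function $\theta:\mathbb R^+\times\mathbb R^+\to\mathbb R^+$ satisfies (i) $\theta(x,y)=\theta(y,x)$; (ii) $\theta(x,y)>0$ if $xy\ne0$; (iii) $\theta\in C^1$; (iv) $\theta(x,y)=0$ if $xy=0$; and $\theta_{ij}(p)=\theta(p_i/\pi_i,p_j/\pi_j)$. For $(i,j)\in E$, $L_{ij}:\mathbb R\to\mathbb R$ satisfies $L_{ij}=L_{ji}$, $L_{ij}(-a)=L_{ij}(a)$, $L_{ij}(0)=0$, and is strictly convex and coercive (superlinear); $H_{ij}(b)=\sup_{a\in\mathbb R}(ab-L_{ij}(a))$. $F=(F_i),\,G=(G_i):\mathcal P(\mathcal X)\to\mathbb R^n$ are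 $C^1$ vector functions (not necessarily gradients). Functions on $\mathcal P(\mathcal X)$ are treated as functions of the $n$ coordinates so that $\partial/\partial p_i$ makes sense.
   Formalization: The formal statement additionally assumes that each derivative H'_{ij}, (i,j) in E, is locally Lipschitz; without this the claim fails, e.g. for two states with L(a)=a^4/4 and θ(x,y)=xy, where a second solution Φ_s=-u(p_s) exists. *)

theory Defs
  imports "HOL-Analysis.Analysis"
begin

section \<open>State space, reversible generator, graph\<close>

definition orthant :: "(real^'n) set" where
  "orthant = {p. \<forall>i. 0 \<le> p $ i}"

definition prob_simplex :: "(real^'n) set" where
  "prob_simplex = {p. (\<forall>i. 0 \<le> p $ i) \<and> (\<Sum>i\<in>UNIV. p $ i) = 1}"

definition invariant_law :: "real^'n^'n \<Rightarrow> real^'n \<Rightarrow> bool" where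
  "invariant_law Q \<mu> \<longleftrightarrow> \<mu> \<in> prob_simplex \<and> (\<forall>j. (\<Sum>i\<in>UNIV. \<mu> $ i * Q $ i $ j) = 0)"

definition reversible_generator :: "real^'n^'n \<Rightarrow> real^'n \<Rightarrow> bool" where
  "reversible_generator Q \<pi> \<longleftrightarrow>
     (\<forall>i j. j \<noteq> i \<longrightarrow> 0 \<le> Q $ i $ j) \<and>
     (\<forall>i. (\<Sum>j\<in>UNIV. Q $ i $ j) = 0) \<and>
     (\<forall>i. 0 < \<pi> $ i) \<and>
     invariant_law Q \<pi> \<and> (\<forall>\<mu>. invariant_law Q \<mu> \<longrightarrow> \<mu> = \<pi>) \<and>
     (\<forall>i j. Q $ i $ j * \<pi> $ i = Q $ j $ i * \<pi> $ j)"

definition weight :: "real^'n^'n \<Rightarrow> real^'n \<Rightarrow> 'n \<Rightarrow> 'n \<Rightarrow> real" where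
  "weight Q \<pi> i j = Q $ i $ j * \<pi> $ i"

definition edges :: "('n \<Rightarrow> 'n \<Rightarrow> real) \<Rightarrow> ('n \<times> 'n) set" where
  "edges \<omega> = {(i, j). i \<noteq> j \<and> 0 < \<omega> i j}"

definition nbrs :: "('n \<Rightarrow> 'n \<Rightarrow> real) \<Rightarrow> 'n \<Rightarrow> 'n set" where
  "nbrs \<omega> i = {j. (i, j) \<in> edges \<omega>}"

section \<open>Differentiability up to the boundary\<close>

text \<open>
  Functions on the simplex are treated as functions of the \<open>n\<close> coordinates, i.e. as functions of
  points of the nonnegative orthant near the simplex; all derivatives are one-sided at a
  boundary point of their domain.

  \<open>C1_on K S f\<close>: at every point of \<open>K\<close> the function \<open>f\<close> is (Frechet) differentiable within the
  ambient domain \<open>S\<close>, and the derivative is continuous on \<open>K\<close>.  For \<open>K\<close> the simplex and \<open>S\<close> the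
  orthant this only involves values of \<open>f\<close> near the simplex, and it holds whenever \<open>f\<close> is
  continuously differentiable on a (relative) neighbourhood of the simplex.
\<close>

definition C1_on :: "'a::real_normed_vector set \<Rightarrow> 'a set \<Rightarrow> ('a \<Rightarrow> 'b::real_normed_vector) \<Rightarrow> bool" where
  "C1_on K S f \<longleftrightarrow>
     (\<exists>f' :: 'a \<Rightarrow> 'a \<Rightarrow>\<^sub>L 'b.
        (\<forall>x\<in>K. (f has_derivative blinfun_apply (f' x)) (at x within S)) \<and> continuous_on K f')"

definition pd :: "(real^'n \<Rightarrow> real) \<Rightarrow> 'n \<Rightarrow> real^'n \<Rightarrow> real" where
  "pd f k p = vector_derivative (\<lambda>x. f (\<chi> l. if l = k then x else p $ l)) (at (p $ k) within {0..})"

section \<open>Discrete gradients\<close>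

definition dgrad :: "('n \<Rightarrow> 'n \<Rightarrow> real) \<Rightarrow> real^'n \<Rightarrow> 'n \<Rightarrow> 'n \<Rightarrow> real" where
  "dgrad \<omega> \<Phi> i j = sqrt (\<omega> i j) * (\<Phi> $ j - \<Phi> $ i)"

definition dgrad_pd :: "('n \<Rightarrow> 'n \<Rightarrow> real) \<Rightarrow> (real^'n \<Rightarrow> real) \<Rightarrow> real^'n \<Rightarrow> 'n \<Rightarrow> 'n \<Rightarrow> real" where
  "dgrad_pd \<omega> f p j k = sqrt (\<omega> j k) * (pd f k p - pd f j p)"

section \<open>Activation function, Lagrangian and Hamiltonian\<close>

definition activation :: "(real \<Rightarrow> real \<Rightarrow> real) \<Rightarrow> bool" where
  "activation \<theta> \<longleftrightarrow>
     (\<forall>x\<ge>0. \<forall>y\<ge>0. 0 \<le> \<theta> x y \<and> \<theta> x y = \<theta> y x \<and>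
        (x * y \<noteq> 0 \<longrightarrow> 0 < \<theta> x y) \<and> (x * y = 0 \<longrightarrow> \<theta> x y = 0)) \<and>
     C1_on ({0..} \<times> {0..}) ({0..} \<times> {0..}) (\<lambda>(x, y). \<theta> x y)"

definition act :: "(real \<Rightarrow> real \<Rightarrow> real) \<Rightarrow> real^'n \<Rightarrow> 'n \<Rightarrow> 'n \<Rightarrow> real^'n \<Rightarrow> real" where
  "act \<theta> \<pi> i j p = \<theta> (p $ i / \<pi> $ i) (p $ j / \<pi> $ j)"

definition strictly_convex :: "(real \<Rightarrow> real) \<Rightarrow> bool" where
  "strictly_convex f \<longleftrightarrow>
     (\<forall>a b t. a \<noteq> b \<and> 0 < t \<and> t < 1 \<longrightarrow> f ((1 - t) * a + t * b) < (1 - t) * f a + t * f b)"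

definition superlinear :: "(real \<Rightarrow> real) \<Rightarrow> bool" where
  "superlinear f \<longleftrightarrow> filterlim (\<lambda>a. f a / \<bar>a\<bar>) at_top at_infinity"

definition lagrangian :: "('n \<times> 'n) set \<Rightarrow> ('n \<Rightarrow> 'n \<Rightarrow> real \<Rightarrow> real) \<Rightarrow> bool" where
  "lagrangian E L \<longleftrightarrow>
     (\<forall>(i, j)\<in>E. L i j = L j i \<and> (\<forall>a. L i j (- a) = L i j a) \<and> L i j 0 = 0 \<and>
        strictly_convex (L i j) \<and> superlinear (L i j))"

definition hamiltonian :: "('n \<Rightarrow> 'n \<Rightarrow> real \<Rightarrow> real) \<Rightarrow> 'n \<Rightarrow> 'n \<Rightarrow> real \<Rightarrow> real" where
  "hamiltonian L i j b = (SUP a. a * b - L i j a)"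

text \<open>
  Strict convexity and superlinearity of \<open>L\<close> make \<open>H\<close> continuously differentiable, but \<open>H'\<close> need not
  be locally Lipschitz: for \<open>L a = a^4 / 4\<close> one gets \<open>H' b = root 3 b\<close>.  Then the mean field game
  system may have a classical solution other than the one generated by the master equation.
  Example: two states, \<open>Q 1 2 = Q 2 1 = 1\<close> (so \<open>\<omega> 1 2 = 1/2\<close>), this \<open>L\<close>, \<open>\<theta> x y = x * y\<close>.  With
  \<open>x = p\<^sub>1 - 1/2\<close> and \<open>v x = - sgn x * \<bar>x\<bar> powr (3/2)\<close> put \<open>u\<^sub>1 = - v x / 2\<close>, \<open>u\<^sub>2 = v x / 2\<close>, constant in
  time.  As \<open>H (dgrad u)\<close> is a multiple of \<open>x^2\<close> and \<open>H' (dgrad u) * pd u\<^sub>i\<close> a multiple of \<open>x\<close>, the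
  function \<open>u\<close> is a \<open>C\<^sup>1\<close> solution of the master equation for a polynomial \<open>F\<close> and \<open>G = u\<close>.  The
  terms involving \<open>u\<close> are even in \<open>u\<close>, so \<open>\<Phi> = - u (p)\<close> solves the backward equation with the same
  \<open>F\<close> along \<open>x' = - sqrt \<omega> * \<theta> * H' (dgrad \<Phi>) = - c * (1 - 4 * x^2) * sgn x * sqrt \<bar>x\<bar>\<close>, \<open>c > 0\<close>.
  This has a solution with \<open>x > 0\<close> before time \<open>T\<close> and \<open>x = 0\<close> at \<open>T\<close>; there \<open>\<Phi> = 0 = G\<close>,
  although \<open>\<Phi> \<noteq> u (p)\<close> before \<open>T\<close>.  Hence the local Lipschitz condition on \<open>H'\<close> is imposed.
\<close>

definition locally_Lipschitz :: "(real \<Rightarrow> real) \<Rightarrow> bool" where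
  "locally_Lipschitz f \<longleftrightarrow> (\<forall>r. \<exists>C. C-lipschitz_on {-r..r} f)"

section \<open>Classical solutions\<close>

definition mfg_solution ::
  "('n::finite \<Rightarrow> 'n \<Rightarrow> real) \<Rightarrow> real^'n \<Rightarrow> (real \<Rightarrow> real \<Rightarrow> real) \<Rightarrow> ('n \<Rightarrow> 'n \<Rightarrow> real \<Rightarrow> real) \<Rightarrow>
   (real^'n \<Rightarrow> real^'n) \<Rightarrow> (real^'n \<Rightarrow> real^'n) \<Rightarrow> real \<Rightarrow> real \<Rightarrow> real^'n \<Rightarrow>
   (real \<Rightarrow> real^'n) \<Rightarrow> (real \<Rightarrow> real^'n) \<Rightarrow> bool" where
  "mfg_solution \<omega> \<pi> \<theta> L F G t T p0 p \<Phi> \<longleftrightarrow>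
     (\<forall>s\<in>{t..T}. p s \<in> prob_simplex) \<and>
     (\<forall>s\<in>{t..T}. \<forall>i.
        ((\<lambda>r. p r $ i) has_real_derivative
           - (\<Sum>j\<in>nbrs \<omega> i. sqrt (\<omega> i j) * act \<theta> \<pi> i j (p s) *
                deriv (hamiltonian L i j) (dgrad \<omega> (\<Phi> s) i j)))
          (at s within {t..T}) \<and>
        ((\<lambda>r. \<Phi> r $ i) has_real_derivative
           - ((\<Sum>j\<in>nbrs \<omega> i. hamiltonian L i j (dgrad \<omega> (\<Phi> s) i j) * pd (act \<theta> \<pi> i j) i (p s)) +
              F (p s) $ i))
          (at s within {t..T})) \<and>
     p t = p0 \<and> (\<forall>i. \<Phi> T $ i = G (p T) $ i)"

definition master_solution ::
  "('n::finite \<Rightarrow> 'n \<Rightarrow> real) \<Rightarrow> real^'n \<Rightarrow> (real \<Rightarrow> real \<Rightarrow> real) \<Rightarrow> ('n \<Rightarrow> 'n \<Rightarrow> real \<Rightarrow> real) \<Rightarrow>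
   (real^'n \<Rightarrow> real^'n) \<Rightarrow> (real^'n \<Rightarrow> real^'n) \<Rightarrow> real \<Rightarrow> (real^'n \<Rightarrow> real \<Rightarrow> real^'n) \<Rightarrow> bool" where
  "master_solution \<omega> \<pi> \<theta> L F G T u \<longleftrightarrow>
     C1_on (prob_simplex \<times> {..T}) (orthant \<times> {..T}) (\<lambda>(p, t). u p t) \<and>
     (\<forall>p\<in>prob_simplex. \<forall>t\<le>T. \<forall>i.
        vector_derivative (\<lambda>\<tau>. u p \<tau> $ i) (at t within {..T}) +
        (\<Sum>j\<in>nbrs \<omega> i. hamiltonian L i j (dgrad \<omega> (u p t) i j) * pd (act \<theta> \<pi> i j) i p) +
        F p $ i +
        1 / 2 * (\<Sum>(j, k)\<in>edges \<omega>. deriv (hamiltonian L j k) (dgrad \<omega> (u p t) j k) *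
                   dgrad_pd \<omega> (\<lambda>q. u q t $ i) p j k * act \<theta> \<pi> j k p) = 0) \<and>
     (\<forall>p\<in>prob_simplex. \<forall>i. u p T $ i = G p $ i)"

end

theory Submission
  imports Defs "HOL-Library.Landau_Symbols"
begin

text \<open>
  Put \<open>v s = u (p s) s\<close> and \<open>w = \<Phi> - v\<close>.  By the chain rule the derivative of \<open>v\<close> is \<open>\<partial>\<^sub>t u\<close> plus
  the derivative of \<open>u\<close> in the direction of the velocity of \<open>p\<close>.  That velocity is a discrete
  divergence: the flux \<open>\<theta>\<^sub>j\<^sub>k H'\<^sub>j\<^sub>k\<close> through an edge is antisymmetric, because \<open>\<theta>\<close> is symmetric and
  \<open>H'\<close> is odd.  A summation by parts (\<open>discrete_integration_by_parts\<close>) therefore turns the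
  directional derivative into the transport term of the master equation, except that \<open>H'\<close> is
  evaluated at the gradient of \<open>\<Phi>\<close> instead of that of \<open>v\<close>.  Replacing \<open>\<partial>\<^sub>t u\<close> by means of the master
  equation, \<open>F\<close> cancels in \<open>w'\<close>, and every remaining term is a difference of \<open>H\<close> or of \<open>H'\<close> at
  the gradients of \<open>\<Phi>\<close> and of \<open>v\<close>, times a function of time that is bounded on \<open>[t, T]\<close>.

  Since \<open>H\<close> and \<open>H'\<close> are Lipschitz on bounded intervals and the two gradients stay bounded, this
  gives \<open>w' = O(w)\<close> uniformly on \<open>[t, T]\<close>.  The terminal conditions say \<open>w T = 0\<close>, so Gronwall's
  inequality run backwards from \<open>T\<close> (\<open>backward_Gronwall_zero\<close>) forces \<open>w = 0\<close>.  "Uniformly on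
  \<open>[t, T]\<close>" is expressed by \<open>O\<close> with respect to the principal filter of the interval, so that
  finite sums and products with bounded factors are covered by the calculus of Landau symbols.

  The function \<open>H\<close> is only given as a supremum.  Its differentiability, without which \<open>deriv\<close> would
  be meaningless and in particular not odd, comes from the strict convexity of \<open>L\<close>: the supremum is
  attained at a unique point, which depends continuously on the slope and is the derivative of \<open>H\<close>
  (\<open>conjugate_differentiable\<close>).
\<close>

section \<open>The convex conjugate of a strictly convex superlinear function\<close>

definition conjugate :: "(real \<Rightarrow> real) \<Rightarrow> real \<Rightarrow> real" where
  "conjugate l b = (SUP a. a * b - l a)"

lemma hamiltonian_eq_conjugate: "hamiltonian L i j = conjugate (L i j)"
  by (simp add: fun_eq_iff hamiltonian_def conjugate_def)

lemma strictly_convexD: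
  assumes "strictly_convex l" "a \<noteq> b" "0 < t" "t < 1"
  shows "l ((1 - t) * a + t * b) < (1 - t) * l a + t * l b"
  using assms unfolding strictly_convex_def by blast

lemma strictly_convex_imp_convex_on:
  assumes "strictly_convex l"
  shows "convex_on UNIV l"
  by (rule convex_on_linorderI) (use strictly_convexD[OF assms] in \<open>auto intro: less_imp_le\<close>)

text \<open>
  Superlinearity confines the maximization to a bounded interval, so continuity of \<open>l\<close> gives a
  maximizer; strict convexity makes it the only one.  The strict inequality expresses both.
\<close>

lemma conjugate_maximizer:
  assumes conv: "strictly_convex l" and "superlinear l"
  obtains a where "\<And>x. x \<noteq> a \<Longrightarrow> x * b - l x < a * b - l a"
proof -
  define g where "g x = l x - x * b" for x
  have "continuous_on UNIV l"
    by (intro convex_on_continuous strictly_convex_imp_convex_on conv open_UNIV)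
  then have cont: "continuous_on S g" for S
    unfolding g_def by (auto intro!: continuous_intros intro: continuous_on_subset)
  have "\<forall>\<^sub>F x in at_infinity. l x / \<bar>x\<bar> \<ge> \<bar>b\<bar> + \<bar>l 0\<bar>"
    using \<open>superlinear l\<close> unfolding superlinear_def filterlim_at_top by blast
  then obtain R where R: "\<And>x. R \<le> \<bar>x\<bar> \<Longrightarrow> \<bar>b\<bar> + \<bar>l 0\<bar> \<le> l x / \<bar>x\<bar>"
    unfolding eventually_at_infinity real_norm_def by blast
  define M where "M = max R 1"
  have far: "g 0 \<le> g x" if "M \<le> \<bar>x\<bar>" for x
  proof -
    have x: "R \<le> \<bar>x\<bar>" "1 \<le> \<bar>x\<bar>" using that by (auto simp: M_def)
    have "(\<bar>b\<bar> + \<bar>l 0\<bar>) * \<bar>x\<bar> \<le> l x"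
      using R[OF x(1)] x(2) by (simp add: pos_le_divide_eq)
    moreover have "\<bar>l 0\<bar> * 1 \<le> \<bar>l 0\<bar> * \<bar>x\<bar>" using x(2) by (intro mult_left_mono) auto
    moreover have "x * b \<le> \<bar>b\<bar> * \<bar>x\<bar>" using abs_ge_self[of "x * b"] by (simp add: abs_mult mult.commute)
    ultimately show ?thesis by (simp add: g_def algebra_simps)
  qed
  have "M \<ge> 0" by (simp add: M_def)
  then obtain a where a: "\<And>x. x \<in> cball 0 M \<Longrightarrow> g a \<le> g x"
    using continuous_attains_inf[of "cball 0 M" g, OF compact_cball _ cont] by force
  have min: "g a \<le> g x" for x
    using a[of x] a[of 0] far[of x] \<open>M \<ge> 0\<close> by (cases "\<bar>x\<bar> \<le> M") auto
  have "x * b - l x < a * b - l a" if "x \<noteq> a" for x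
  proof (rule ccontr)
    assume "\<not> ?thesis"
    then have "g x \<le> g a" by (simp add: g_def)
    \<comment> \<open>A second minimizer would make the value at the midpoint smaller still.\<close>
    moreover have "g ((1 - 1 / 2) * x + 1 / 2 * a) < (1 - 1 / 2) * g x + 1 / 2 * g a"
      using strictly_convexD[OF conv that, of "1 / 2"] by (simp add: g_def algebra_simps)
    ultimately show False using min[of "(1 - 1 / 2) * x + 1 / 2 * a"] by simp
  qed
  then show thesis by (rule that)
qed

lemma conjugate_at_maximizer:
  assumes "\<And>x. x \<noteq> a \<Longrightarrow> x * b - l x < a * b - l a"
  shows "conjugate l b = a * b - l a"
  unfolding conjugate_def
  by (rule cSup_eq_maximum) (use assms in \<open>auto simp: image_iff intro: less_imp_le\<close>, 
      metis assms less_imp_le order_refl)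

text \<open>
  The maximizer depends continuously on the slope.  The gap between the maximum and the values at
  the two points \<open>a \<plusminus> e\<close> survives a small change of the slope, and by concavity of
  \<open>\<lambda>x. x * b' - l x\<close> no point beyond \<open>a \<plusminus> e\<close> can then exceed the value at \<open>a\<close>.
\<close>

lemma maximizer_stable:
  assumes conv: "strictly_convex l"
    and a: "\<And>x. x \<noteq> a \<Longrightarrow> x * b - l x < a * b - l a"
    and "e > 0"
  obtains d where "d > 0"
    "\<And>b' a'. \<bar>b' - b\<bar> < d \<Longrightarrow> (\<And>x. x \<noteq> a' \<Longrightarrow> x * b' - l x < a' * b' - l a') \<Longrightarrow> \<bar>a' - a\<bar> \<le> e"
proof -
  define gap where "gap c = (a * b - l a) - (c * b - l c)" for c
  define d where "d = min (gap (a + e)) (gap (a - e)) / e"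
  have "d > 0" using a[of "a + e"] a[of "a - e"] \<open>e > 0\<close> by (simp add: d_def gap_def)
  moreover have "\<bar>a' - a\<bar> \<le> e"
    if b': "\<bar>b' - b\<bar> < d" and a': "\<And>x. x \<noteq> a' \<Longrightarrow> x * b' - l x < a' * b' - l a'" for b' a'
  proof (rule ccontr)
    assume "\<not> ?thesis"
    then have far: "e < \<bar>a' - a\<bar>" by simp
    define t where "t = e / \<bar>a' - a\<bar>"
    \<comment> \<open>The point at distance \<open>e\<close> from \<open>a\<close> in the direction of \<open>a'\<close>.\<close>
    define c where "c = (1 - t) * a + t * a'"
    have t: "0 < t" "t < 1" using far \<open>e > 0\<close> by (auto simp: t_def)
    have c: "c = a + e * sgn (a' - a)"
      using far \<open>e > 0\<close> by (auto simp: c_def t_def algebra_simps sgn_if abs_if divide_simps)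
    have "\<bar>b' - b\<bar> * e < gap c"
    proof -
      have "\<bar>b' - b\<bar> * e < min (gap (a + e)) (gap (a - e))"
        using b' \<open>e > 0\<close> by (simp add: d_def pos_less_divide_eq)
      then show ?thesis using c far \<open>e > 0\<close> by (auto simp: sgn_if split: if_splits)
    qed
    moreover have "(c - a) * (b' - b) \<le> e * \<bar>b' - b\<bar>"
    proof -
      have "\<bar>(c - a) * (b' - b)\<bar> = e * \<bar>b' - b\<bar>"
        using c far \<open>e > 0\<close> by (auto simp: abs_mult sgn_if)
      then show ?thesis by linarith
    qed
    ultimately have "c * b' - l c < a * b' - l a" by (simp add: gap_def algebra_simps)
    moreover have "a * b' - l a < a' * b' - l a'" using a'[of a] far \<open>e > 0\<close> by force
    moreover have "(1 - t) * (a * b' - l a) + t * (a' * b' - l a') < c * b' - l c"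
      using strictly_convexD[OF conv _ t, of a a'] far \<open>e > 0\<close> by (force simp: c_def algebra_simps)
    moreover have "t * (a * b' - l a) < t * (a' * b' - l a')"
      using calculation(2) t by simp
    ultimately show False by (simp add: left_diff_distrib)
  qed
  ultimately show thesis by (rule that)
qed

text \<open>
  If \<open>a\<close> and \<open>a'\<close> are the maximizers at slopes \<open>b\<close> and \<open>y\<close>, then testing each in the other supremum
  gives \<open>a * (y - b) \<le> conjugate l y - conjugate l b \<le> a' * (y - b)\<close>; as \<open>a'\<close> is close to \<open>a\<close> for
  \<open>y\<close> close to \<open>b\<close>, the derivative at \<open>b\<close> is \<open>a\<close>.
\<close>

lemma conjugate_differentiable:
  assumes conv: "strictly_convex l" and superl: "superlinear l"
  shows "conjugate l field_differentiable at b"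
proof -
  obtain a where a: "\<And>x. x \<noteq> a \<Longrightarrow> x * b - l x < a * b - l a"
    using conjugate_maximizer[OF conv superl] by blast
  have "(conjugate l has_derivative (*) a) (at b)"
    unfolding has_derivative_at_alt
  proof (intro conjI allI impI)
    fix e :: real assume "e > 0"
    then obtain d where d: "d > 0" and stable:
      "\<And>b' a'. \<bar>b' - b\<bar> < d \<Longrightarrow> (\<And>x. x \<noteq> a' \<Longrightarrow> x * b' - l x < a' * b' - l a') \<Longrightarrow> \<bar>a' - a\<bar> \<le> e"
      using maximizer_stable[where l = l and a = a and b = b and e = e] conv a by metis
    have "\<bar>conjugate l y - conjugate l b - a * (y - b)\<bar> \<le> e * \<bar>y - b\<bar>" if "\<bar>y - b\<bar> < d" for y
    proof -
      obtain a' where a': "\<And>x. x \<noteq> a' \<Longrightarrow> x * y - l x < a' * y - l a'"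
        using conjugate_maximizer[OF conv superl] by blast
      have "a * y - l a \<le> a' * y - l a'" "a' * b - l a' \<le> a * b - l a"
        using a[of a'] a'[of a] by (cases "a = a'"; simp)+
      then have "\<bar>conjugate l y - conjugate l b - a * (y - b)\<bar> \<le> \<bar>(a' - a) * (y - b)\<bar>"
        by (simp add: conjugate_at_maximizer[OF a] conjugate_at_maximizer[OF a'] algebra_simps)
      also have "\<dots> \<le> e * \<bar>y - b\<bar>"
        using stable[OF that a'] by (auto simp: abs_mult intro: mult_right_mono)
      finally show ?thesis .
    qed
    with d show "\<exists>d>0. \<forall>y. norm (y - b) < d \<longrightarrow>
        norm (conjugate l y - conjugate l b - a * (y - b)) \<le> e * norm (y - b)"
      by auto
  qed (rule bounded_linear_mult_right)
  then show ?thesis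
    unfolding field_differentiable_def has_field_derivative_def by blast
qed

lemma conjugate_even:
  assumes "\<And>a. l (- a) = l a"
  shows "conjugate l (- b) = conjugate l b"
proof -
  have "range (\<lambda>a. a * (- b) - l a) = (\<lambda>a. a * (- b) - l a) ` range uminus"
    by simp
  also have "\<dots> = range (\<lambda>a. a * b - l a)"
    unfolding image_image by (simp only: assms minus_mult_minus)
  finally show ?thesis by (simp add: conjugate_def)
qed

lemma deriv_even:
  fixes f :: "real \<Rightarrow> real"
  assumes diff: "f field_differentiable at b" and even: "\<And>x. f (- x) = f x"
  shows "deriv f (- b) = - deriv f b"
proof (rule DERIV_imp_deriv)
  have "(f has_real_derivative deriv f b) (at (- (- b)))"
    using diff by (simp add: field_differentiable_derivI)
  then have "((\<lambda>x. f (- x)) has_real_derivative - deriv f b) (at (- b))"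
    by (subst (asm) DERIV_mirror)
  then show "(f has_real_derivative - deriv f b) (at (- b))"
    by (simp add: even)
qed

lemma locally_Lipschitz_antiderivative:
  assumes diff: "\<And>b. f field_differentiable at b" and lip: "locally_Lipschitz (deriv f)"
  shows "locally_Lipschitz f"
  unfolding locally_Lipschitz_def
proof
  fix r :: real
  obtain C where "C-lipschitz_on {- r..r} (deriv f)"
    using lip unfolding locally_Lipschitz_def by blast
  then have "compact (deriv f ` {- r..r})"
    by (intro compact_continuous_image lipschitz_on_continuous_on compact_Icc)
  then obtain B where "B > 0" and B: "\<And>x. x \<in> {- r..r} \<Longrightarrow> norm (deriv f x) \<le> B"
    using compact_imp_bounded bounded_pos by (metis imageI)
  have "norm (f x - f y) \<le> B * norm (x - y)" if "x \<in> {- r..r}" "y \<in> {- r..r}" for x y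
    by (rule field_differentiable_bound[where S = "{- r..r}" and f' = "deriv f"])
       (use that B diff in \<open>auto intro: has_field_derivative_at_within field_differentiable_derivI\<close>)
  then show "\<exists>C. C-lipschitz_on {- r..r} f"
    using \<open>B > 0\<close> by (auto simp: lipschitz_on_def dist_norm intro!: exI[of _ B])
qed

section \<open>Partial derivatives and differentiation along curves\<close>

text \<open>
  All derivatives are one-sided at boundary points, so every composition has to map the domain of
  the inner function into the set within which the outer one is differentiated.
\<close>

lemma has_derivative_compose_into:
  assumes "(f has_derivative f') (at x within S)" "f ` S \<subseteq> R"
    and "(g has_derivative g') (at (f x) within R)"
  shows "((\<lambda>x. g (f x)) has_derivative (\<lambda>x. g' (f' x))) (at x within S)"
  using has_derivative_in_compose[OF assms(1) has_derivative_subset[OF assms(3,2)]] .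

lemma has_vector_derivative_cart:
  fixes f :: "real \<Rightarrow> real^'n"
  assumes "\<And>i. ((\<lambda>x. f x $ i) has_real_derivative f' $ i) (at x within S)"
  shows "(f has_vector_derivative f') (at x within S)"
  unfolding has_vector_derivative_def
  by (subst has_derivative_componentwise_within)
     (use assms in \<open>auto simp: Basis_vec_def inner_axis has_field_derivative_def mult_commute_abs\<close>)

text \<open>
  A coordinate line through a point of the orthant, restricted to nonnegative parameters, stays in
  the orthant.  Hence the one-sided partial derivative is a value of the derivative within the
  orthant, although the line leaves the simplex.
\<close>

lemma pd_eq:
  assumes f: "(f has_derivative f') (at p within orthant)" and p: "p \<in> orthant"
  shows "pd f k p = f' (axis k 1)"
proof -
  define c where "c x = (\<chi> l. if l = k then x else p $ l)" for x
  have "(c has_vector_derivative axis k 1) (at (p $ k) within {0..})"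
    by (rule has_vector_derivative_cart) (auto simp: c_def axis_def)
  moreover have "c ` {0..} \<subseteq> orthant"
    using p by (auto simp: c_def orthant_def)
  moreover have ck: "c (p $ k) = p" by (auto simp: c_def vec_eq_iff)
  ultimately have "((\<lambda>x. f (c x)) has_derivative (\<lambda>h. f' (h *\<^sub>R axis k 1))) (at (p $ k) within {0..})"
    unfolding has_vector_derivative_def
    using has_derivative_compose_into[of c _ "p $ k" "{0..}" orthant f f'] f by simp
  moreover have "f' (h *\<^sub>R axis k 1) = h *\<^sub>R f' (axis k 1)" for h
    using has_derivative_bounded_linear[OF f] by (simp add: linear_simps)
  ultimately have "((\<lambda>x. f (c x)) has_vector_derivative f' (axis k 1)) (at (p $ k) within {0..})"
    by (simp add: has_vector_derivative_def)
  moreover have "at (p $ k) within {0..} \<noteq> bot"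
    unfolding trivial_limit_within not_not
  proof (rule connected_imp_perfect)
    show "p $ k \<in> {0..}" using p by (simp add: orthant_def)
    show "{0..} \<noteq> {x}" for x :: real
      using atLeast_eq_iff infinite_Ici[of "0::real"] by (metis finite.emptyI finite.insertI)
  qed (rule connected_Ici)
  ultimately show ?thesis
    unfolding pd_def c_def by (intro vector_derivative_within)
qed

lemma prob_simplex_subset_orthant: "prob_simplex \<subseteq> orthant"
  by (auto simp: prob_simplex_def orthant_def)

lemma compact_prob_simplex: "compact (prob_simplex :: (real^'n) set)"
proof -
  have "norm p \<le> 1" if "p \<in> prob_simplex" for p :: "real^'n"
    using norm_le_l1_cart[of p] that by (simp add: prob_simplex_def)
  then have "bounded (prob_simplex :: (real^'n) set)"
    unfolding bounded_iff by blast
  moreover have "closed (prob_simplex :: (real^'n) set)"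
    unfolding prob_simplex_def Collect_conj_eq
    by (intro closed_Int closed_Collect_all closed_Collect_le closed_Collect_eq continuous_intros)
  ultimately show ?thesis by (simp add: compact_eq_bounded_closed)
qed

lemma bounded_continuous_image:
  assumes "compact K" "continuous_on K f"
  shows "bounded (f ` K)"
  using assms by (intro compact_imp_bounded compact_continuous_image)

lemma act_has_derivative:
  assumes \<theta>': "((\<lambda>(x, y). \<theta> x y) has_derivative \<theta>') (at (p $ i / \<pi> $ i, p $ j / \<pi> $ j) within {0..} \<times> {0..})"
    and pos: "\<And>i. 0 < \<pi> $ i"
  shows "(act \<theta> \<pi> i j has_derivative (\<lambda>h. \<theta>' (h $ i / \<pi> $ i, h $ j / \<pi> $ j))) (at p within orthant)"
proof -
  let ?c = "\<lambda>p. (p $ i / \<pi> $ i, p $ j / \<pi> $ j)"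
  have "(?c has_derivative ?c) (at p within orthant)"
    by (intro bounded_linear_imp_has_derivative bounded_linear_Pair
        bounded_linear_compose[OF bounded_linear_divide bounded_linear_vec_nth])
  moreover have "?c ` orthant \<subseteq> {0..} \<times> {0..}"
    using pos by (auto simp: orthant_def intro!: divide_nonneg_pos)
  ultimately have "((\<lambda>p. case ?c p of (x, y) \<Rightarrow> \<theta> x y) has_derivative (\<lambda>h. \<theta>' (?c h))) (at p within orthant)"
    using \<theta>' by (rule has_derivative_compose_into)
  then show ?thesis by (simp add: act_def[abs_def])
qed

text \<open>
  On the compact simplex both functions are continuous: the partial derivative inherits this from
  the continuous derivative of \<open>\<theta>\<close> through \<open>pd_eq\<close>.
\<close>

lemma bounded_act_pd_act:
  fixes \<pi> :: "real^'n"
  assumes \<theta>: "activation \<theta>" and pos: "\<And>i. 0 < \<pi> $ i"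
  shows "bounded (act \<theta> \<pi> i j ` prob_simplex)" "bounded (pd (act \<theta> \<pi> i j) k ` prob_simplex)"
proof -
  let ?c = "\<lambda>p :: real^'n. (p $ i / \<pi> $ i, p $ j / \<pi> $ j)"
  obtain \<theta>' :: "real \<times> real \<Rightarrow> (real \<times> real) \<Rightarrow>\<^sub>L real" where
    \<theta>': "\<And>z. z \<in> {0..} \<times> {0..} \<Longrightarrow>
        ((\<lambda>(x, y). \<theta> x y) has_derivative blinfun_apply (\<theta>' z)) (at z within {0..} \<times> {0..})"
    and cont: "continuous_on ({0..} \<times> {0..}) \<theta>'"
    using \<theta> unfolding activation_def C1_on_def by blast
  have c: "?c p \<in> {0..} \<times> {0..}" if "p \<in> prob_simplex" for p
    using that pos by (auto simp: prob_simplex_def intro!: divide_nonneg_pos)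
  have D: "(act \<theta> \<pi> i j has_derivative (\<lambda>h. \<theta>' (?c p) (?c h))) (at p within orthant)"
    if "p \<in> prob_simplex" for p
    using act_has_derivative[OF \<theta>'[OF c[OF that]] pos] .
  have "continuous_on prob_simplex (act \<theta> \<pi> i j)"
    by (rule has_derivative_continuous_on)
       (rule has_derivative_subset[OF D prob_simplex_subset_orthant])
  then show "bounded (act \<theta> \<pi> i j ` prob_simplex)"
    by (rule bounded_continuous_image[OF compact_prob_simplex])
  have "continuous_on prob_simplex (\<lambda>p. \<theta>' (?c p))"
    by (rule continuous_on_compose2[OF cont])
       (use c pos in \<open>auto intro!: continuous_intros simp: less_imp_neq[symmetric]\<close>)
  then have "continuous_on prob_simplex (\<lambda>p. \<theta>' (?c p) (?c (axis k 1)))"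
    by (intro continuous_intros)
  then have "continuous_on prob_simplex (pd (act \<theta> \<pi> i j) k)"
    by (rule continuous_on_eq)
       (use pd_eq[OF D] prob_simplex_subset_orthant in auto)
  then show "bounded (pd (act \<theta> \<pi> i j) k ` prob_simplex)"
    by (rule bounded_continuous_image[OF compact_prob_simplex])
qed

text \<open>
  The partial derivatives in the master equation are values of one Frechet derivative \<open>D\<close> on the
  coordinate directions.  The second statement is the linearity of \<open>D\<close> in these terms, for the
  direction \<open>(h, 1)\<close> of a curve \<open>(p s, s)\<close> with velocity \<open>h\<close> of \<open>p\<close>.
\<close>

lemma partial_derivatives:
  fixes u :: "real^'n \<Rightarrow> real \<Rightarrow> real^'n"
  assumes D: "((\<lambda>(p, t). u p t) has_derivative D) (at (q, s) within orthant \<times> {..T})"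
    and q: "q \<in> orthant" and s: "s \<le> T"
  shows partial_space: "pd (\<lambda>q. u q s $ i) k q = D (axis k 1, 0) $ i"
    and total_derivative: "D (h, 1) $ i
      = vector_derivative (\<lambda>\<tau>. u q \<tau> $ i) (at s within {..T}) + (\<Sum>k\<in>UNIV. h $ k * pd (\<lambda>q. u q s $ i) k q)"
proof -
  have lin: "linear D" using D by (rule has_derivative_linear)
  have Di: "((\<lambda>(p, t). u p t $ i) has_derivative (\<lambda>h. D h $ i)) (at (q, s) within orthant \<times> {..T})"
    using bounded_linear.has_derivative[OF bounded_linear_vec_nth D]
    by (simp add: case_prod_unfold)
  have "((\<lambda>q. case (q, s) of (p, t) \<Rightarrow> u p t $ i) has_derivative (\<lambda>h. D (h, 0) $ i)) (at q within orthant)"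
    by (rule has_derivative_compose_into[where f = "\<lambda>q. (q, s)", OF _ _ Di])
       (use s in \<open>auto intro!: derivative_eq_intros\<close>)
  then show space: "pd (\<lambda>q. u q s $ i) k q = D (axis k 1, 0) $ i" for k
    using pd_eq[OF _ q] by auto
  have "((\<lambda>\<tau>. case (q, \<tau>) of (p, t) \<Rightarrow> u p t $ i) has_derivative (\<lambda>h. D (0, h) $ i)) (at s within {..T})"
    by (rule has_derivative_compose_into[where f = "\<lambda>\<tau>. (q, \<tau>)", OF _ _ Di])
       (use q in \<open>auto intro!: derivative_eq_intros\<close>)
  moreover have "(\<lambda>h. D (0, h) $ i) = (\<lambda>h. h *\<^sub>R (D (0, 1) $ i))"
  proof
    fix h
    have "D (0, h) = D (h *\<^sub>R (0, 1))" by simp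
    also have "\<dots> = h *\<^sub>R D (0, 1)" by (rule linear_scale[OF lin])
    finally show "D (0, h) $ i = h *\<^sub>R (D (0, 1) $ i)" by (simp only: vector_scaleR_component)
  qed
  ultimately have "((\<lambda>\<tau>. u q \<tau> $ i) has_vector_derivative D (0, 1) $ i) (at s within {..T})"
    unfolding has_vector_derivative_def by simp
  moreover have "at s within {..T} \<noteq> bot"
    unfolding trivial_limit_within not_not
  proof (rule connected_imp_perfect)
    show "s \<in> {..T}" using s by simp
    show "{..T} \<noteq> {x}" for x :: real
      using infinite_Iic[of T] by (metis finite.emptyI finite.insertI)
  qed (rule connected_Iic)
  ultimately have time: "vector_derivative (\<lambda>\<tau>. u q \<tau> $ i) (at s within {..T}) = D (0, 1) $ i"
    by (intro vector_derivative_within)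
  have "(\<Sum>k\<in>UNIV. h $ k *\<^sub>R axis k 1) = h"
    using basis_expansion[of h] by (simp add: scalar_mult_eq_scaleR)
  then have "(h, 1 :: real) = (0, 1) + (\<Sum>k\<in>UNIV. h $ k *\<^sub>R (axis k 1, 0))"
    by (simp add: prod_eq_iff fst_sum snd_sum)
  then have "D (h, 1) = D (0, 1) + (\<Sum>k\<in>UNIV. h $ k *\<^sub>R D (axis k 1, 0))"
    by (simp only: linear_add[OF lin] linear_sum[OF lin] linear_scale[OF lin])
  then show "D (h, 1) $ i
      = vector_derivative (\<lambda>\<tau>. u q \<tau> $ i) (at s within {..T}) + (\<Sum>k\<in>UNIV. h $ k * pd (\<lambda>q. u q s $ i) k q)"
    by (simp add: space time)
qed

section \<open>Discrete integration by parts\<close>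

text \<open>
  Exchanging the endpoints of the edges turns \<open>m k j * x $ k\<close> into \<open>- m k j * x $ j\<close>.  The
  factor \<open>1 / 2\<close> compensates that \<open>edges \<omega>\<close> contains both orientations of each edge.
\<close>

lemma discrete_integration_by_parts:
  fixes x :: "real^'n::finite"
  assumes sym: "\<And>j k. (j, k) \<in> edges \<omega> \<Longrightarrow> (k, j) \<in> edges \<omega> \<and> \<omega> j k = \<omega> k j"
    and anti: "\<And>j k. (j, k) \<in> edges \<omega> \<Longrightarrow> m k j = - m j k"
  shows "(\<Sum>k\<in>UNIV. - (\<Sum>j\<in>nbrs \<omega> k. sqrt (\<omega> k j) * m k j) * x $ k)
       = 1 / 2 * (\<Sum>(j, k)\<in>edges \<omega>. m j k * dgrad \<omega> x j k)"
proof -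
  let ?E = "edges \<omega>"
  let ?S = "\<Sum>(k, j)\<in>?E. sqrt (\<omega> k j) * m k j * x $ k"
  have E: "?E = Sigma UNIV (nbrs \<omega>)" by (auto simp: nbrs_def)
  have "(\<Sum>k\<in>UNIV. - (\<Sum>j\<in>nbrs \<omega> k. sqrt (\<omega> k j) * m k j) * x $ k) = - ?S"
    unfolding E by (subst sum.Sigma[symmetric]) (auto simp: sum_distrib_right sum_negf)
  moreover have "?S = (\<Sum>(k, j)\<in>?E. - (sqrt (\<omega> k j) * m k j * x $ j))"
  proof (rule sum.reindex_bij_witness[of _ prod.swap prod.swap])
    fix e assume "e \<in> ?E"
    then show "prod.swap e \<in> ?E" using sym by (cases e) auto
  next
    fix e assume "e \<in> ?E"
    then show "prod.swap e \<in> ?E" using sym by (cases e) auto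
  next
    fix e assume "e \<in> ?E"
    then show "(case prod.swap e of (k, j) \<Rightarrow> - (sqrt (\<omega> k j) * m k j * x $ j)) =
        (case e of (k, j) \<Rightarrow> sqrt (\<omega> k j) * m k j * x $ k)"
      using sym[of "fst e" "snd e"] anti[of "fst e" "snd e"] by (cases e) auto
  qed auto
  moreover have "(\<Sum>(j, k)\<in>?E. m j k * dgrad \<omega> x j k)
      = (\<Sum>(k, j)\<in>?E. - (- (sqrt (\<omega> k j) * m k j * x $ j))) - ?S"
    unfolding sum_subtractf[symmetric]
    by (intro sum.cong) (auto simp: dgrad_def algebra_simps)
  moreover have "(\<Sum>(k, j)\<in>?E. - (- (sqrt (\<omega> k j) * m k j * x $ j)))
      = - (\<Sum>(k, j)\<in>?E. - (sqrt (\<omega> k j) * m k j * x $ j))"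
    unfolding sum_negf[symmetric] by (intro sum.cong) auto
  ultimately show ?thesis by simp
qed

section \<open>Backward Gronwall inequality and uniform bounds\<close>

text \<open>
  If \<open>norm w' \<le> C * norm w\<close>, then \<open>(norm w)\<^sup>2 * exp (2 * C * s)\<close> is nondecreasing in \<open>s\<close>; as it
  vanishes at \<open>T\<close>, it vanishes before.
\<close>

lemma backward_Gronwall_zero:
  fixes w :: "real \<Rightarrow> 'a::real_inner"
  assumes deriv: "\<And>s. s \<in> {t..T} \<Longrightarrow> (w has_vector_derivative w' s) (at s within {t..T})"
    and bigo: "(\<lambda>s. norm (w' s)) \<in> O[principal {t..T}](\<lambda>s. norm (w s))"
    and final: "w T = 0" and s: "s \<in> {t..T}"
  shows "w s = 0"
proof -
  obtain C where "\<forall>\<^sub>F s in principal {t..T}. norm (norm (w' s)) \<le> C * norm (norm (w s))"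
    using bigo by (elim landau_o.bigE)
  then have C: "norm (w' s) \<le> C * norm (w s)" if "s \<in> {t..T}" for s
    using that by (simp add: eventually_principal)
  define e where "e s = (w s \<bullet> w s) * exp (2 * C * s)" for s
  have De: "(e has_real_derivative 2 * (w x \<bullet> w' x + C * (w x \<bullet> w x)) * exp (2 * C * x))
      (at x within {t..T})" if "x \<in> {t..T}" for x
  proof -
    have "((\<lambda>s. w s \<bullet> w s) has_real_derivative 2 * (w x \<bullet> w' x)) (at x within {t..T})"
      using bounded_bilinear.has_vector_derivative[OF bounded_bilinear_inner deriv[OF that] deriv[OF that]]
      by (simp add: has_real_derivative_iff_has_vector_derivative inner_commute)
    moreover have "((\<lambda>s. exp (2 * C * s)) has_real_derivative 2 * C * exp (2 * C * x))
        (at x within {t..T})"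
      by (auto intro!: derivative_eq_intros)
    ultimately show ?thesis
      unfolding e_def by (rule DERIV_cong[OF DERIV_mult]) (simp add: algebra_simps)
  qed
  have "e s \<le> e T"
  proof (rule DERIV_nonneg_imp_increasing_open[of s T e])
    show "s \<le> T" using s by simp
    show "continuous_on {s..T} e"
      by (rule continuous_on_subset[OF DERIV_continuous_on[OF De]]) (use s in auto)
    fix x assume x: "s < x" "x < T"
    then have int: "x \<in> interior {t..T}" and mem: "x \<in> {t..T}" using s by auto
    have "\<bar>w x \<bullet> w' x\<bar> \<le> norm (w x) * norm (w' x)" by (rule Cauchy_Schwarz_ineq2)
    also have "\<dots> \<le> norm (w x) * (C * norm (w x))" by (intro mult_left_mono C mem) simp
    also have "\<dots> = C * (w x \<bullet> w x)" by (simp add: dot_square_norm power2_eq_square)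
    finally show "\<exists>y. (e has_real_derivative y) (at x) \<and> 0 \<le> y"
      using De[OF mem] at_within_interior[OF int] by (intro exI conjI) auto
  qed
  then have "w s \<bullet> w s \<le> 0"
    by (simp add: e_def final mult_le_0_iff)
  then show ?thesis by (metis inner_gt_zero_iff not_less)
qed

lemma bigo_locally_Lipschitz:
  fixes x y :: "'a \<Rightarrow> real"
  assumes lip: "locally_Lipschitz f"
    and bnd: "bounded (x ` I)" "bounded (y ` I)"
    and diff: "(\<lambda>s. x s - y s) \<in> O[principal I](g)"
  shows "(\<lambda>s. f (x s) - f (y s)) \<in> O[principal I](g)"
proof -
  obtain r where r: "\<And>z. z \<in> x ` I \<union> y ` I \<Longrightarrow> norm z \<le> r"
    using bounded_Un[of "x ` I" "y ` I"] bnd bounded_iff[of "x ` I \<union> y ` I"] by auto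
  obtain C where C: "C-lipschitz_on {- r..r} f"
    using lip unfolding locally_Lipschitz_def by blast
  have "norm (f (x s) - f (y s)) \<le> C * norm (x s - y s)" if "s \<in> I" for s
    using lipschitz_onD[OF C, of "x s" "y s"] r[of "x s"] r[of "y s"] that
    by (simp add: dist_norm abs_le_iff)
  then have "(\<lambda>s. f (x s) - f (y s)) \<in> O[principal I](\<lambda>s. x s - y s)"
    by (intro bigoI) (auto simp: eventually_principal)
  then show ?thesis using diff by (rule landau_o.big.trans)
qed

lemma bounded_imp_bigo_1:
  fixes f :: "'a \<Rightarrow> real"
  assumes "bounded (f ` I)"
  shows "f \<in> O[principal I](\<lambda>_. 1)"
proof -
  obtain B where "\<And>s. s \<in> I \<Longrightarrow> norm (f s) \<le> B"
    using assms unfolding bounded_iff by blast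
  then show ?thesis by (intro bigoI[of _ B]) (auto simp: eventually_principal)
qed

lemma bigo_mult_bounded:
  fixes f h :: "'a \<Rightarrow> real"
  assumes "f \<in> O[principal I](g)" "bounded (h ` I)"
  shows "(\<lambda>s. f s * h s) \<in> O[principal I](g)"
  using landau_o.big.mult[OF assms(1) bounded_imp_bigo_1[OF assms(2)]] by simp

lemma dgrad_diff: "dgrad \<omega> x i j - dgrad \<omega> y i j = dgrad \<omega> (x - y) i j"
  by (simp add: dgrad_def algebra_simps)

lemma abs_dgrad_le:
  fixes x :: "real^'n"
  shows "\<bar>dgrad \<omega> x i j\<bar> \<le> sqrt \<bar>\<omega> i j\<bar> * 2 * norm x"
proof -
  have "\<bar>x $ j - x $ i\<bar> \<le> 2 * norm x"
    using component_le_norm_cart[of x i] component_le_norm_cart[of x j] by linarith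
  then show ?thesis
    by (simp add: dgrad_def abs_mult mult.assoc real_sqrt_abs' mult_left_mono)
qed

lemma bigo_dgrad_diff:
  fixes x y :: "'a \<Rightarrow> real^'n"
  shows "(\<lambda>s. dgrad \<omega> (x s) i j - dgrad \<omega> (y s) i j) \<in> O[principal I](\<lambda>s. norm (x s - y s))"
  by (rule bigoI[of _ "sqrt \<bar>\<omega> i j\<bar> * 2"])
     (simp add: eventually_principal dgrad_diff abs_dgrad_le)

text \<open>
  Along continuous curves the discrete gradients stay in a bounded interval, where the Lipschitz
  constant of \<open>f\<close> is uniform.
\<close>

lemma bigo_dgrad_Lipschitz:
  fixes x y :: "real \<Rightarrow> real^'n"
  assumes lip: "locally_Lipschitz f" and cont: "continuous_on {t..T} x" "continuous_on {t..T} y"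
  shows "(\<lambda>s. f (dgrad \<omega> (x s) i j) - f (dgrad \<omega> (y s) i j))
      \<in> O[principal {t..T}](\<lambda>s. norm (x s - y s))"
  by (intro bigo_locally_Lipschitz[OF lip] bigo_dgrad_diff bounded_continuous_image compact_Icc)
     (auto simp: dgrad_def intro!: continuous_intros cont)

lemma norm_vec_bigo:
  fixes f :: "'a \<Rightarrow> real^'n"
  assumes "\<And>i. (\<lambda>s. f s $ i) \<in> O[F](g)"
  shows "(\<lambda>s. norm (f s)) \<in> O[F](g)"
proof (rule landau_o.big.trans)
  show "(\<lambda>s. norm (f s)) \<in> O[F](\<lambda>s. \<Sum>i\<in>UNIV. \<bar>f s $ i\<bar>)"
    by (rule bigoI[of _ 1]) (auto simp: sum_nonneg intro!: always_eventually norm_le_l1_cart)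
  show "(\<lambda>s. \<Sum>i\<in>UNIV. \<bar>f s $ i\<bar>) \<in> O[F](g)"
    using assms by (intro big_sum_in_bigo) simp
qed

section \<open>The mean field game along the master equation\<close>

lemma dgrad_pd_eq_dgrad: "dgrad_pd \<omega> f p j k = dgrad \<omega> (\<chi> k. pd f k p) j k"
  by (simp add: dgrad_pd_def dgrad_def)

lemma edges_weight_sym:
  assumes "reversible_generator Q \<pi>" "(i, j) \<in> edges (weight Q \<pi>)"
  shows "(j, i) \<in> edges (weight Q \<pi>) \<and> weight Q \<pi> i j = weight Q \<pi> j i"
proof -
  have "weight Q \<pi> i j = weight Q \<pi> j i"
    using assms(1) unfolding reversible_generator_def weight_def by blast
  then show ?thesis using assms(2) by (auto simp: edges_def)
qed

lemma act_sym:
  assumes "activation \<theta>" "\<And>i. 0 < \<pi> $ i" "p \<in> prob_simplex"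
  shows "act \<theta> \<pi> i j p = act \<theta> \<pi> j i p"
proof -
  have "0 \<le> p $ k / \<pi> $ k" for k
    using assms(2)[of k] assms(3) by (simp add: prob_simplex_def)
  then show ?thesis
    using assms(1) unfolding activation_def act_def by blast
qed

text \<open>
  Reversing an edge changes the sign of the discrete gradient, and \<open>H'\<close> is odd since \<open>L\<close> is even.
\<close>

lemma hamiltonian_deriv_antisym:
  assumes L: "lagrangian E L" and ij: "(i, j) \<in> E" and \<omega>: "\<omega> i j = \<omega> j i"
  shows "deriv (hamiltonian L j i) (dgrad \<omega> x j i) = - deriv (hamiltonian L i j) (dgrad \<omega> x i j)"
proof -
  have l: "L i j = L j i" "\<And>a. L i j (- a) = L i j a" "strictly_convex (L i j)" "superlinear (L i j)"
    using L ij unfolding lagrangian_def by blast+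
  have "deriv (conjugate (L i j)) (- dgrad \<omega> x i j) = - deriv (conjugate (L i j)) (dgrad \<omega> x i j)"
    using l by (intro deriv_even conjugate_differentiable conjugate_even)
  moreover have "dgrad \<omega> x j i = - dgrad \<omega> x i j"
    using \<omega> by (simp add: dgrad_def algebra_simps)
  ultimately show ?thesis
    using l(1) by (simp add: hamiltonian_eq_conjugate)
qed

theorem lemma4p3:
  fixes Q :: "real^'n^'n" and \<pi> :: "real^'n"
    and \<omega> :: "'n::finite \<Rightarrow> 'n \<Rightarrow> real"
    and \<theta> :: "real \<Rightarrow> real \<Rightarrow> real"
    and L :: "'n \<Rightarrow> 'n \<Rightarrow> real \<Rightarrow> real"
    and F G :: "real^'n \<Rightarrow> real^'n"
    and t T :: real and p0 :: "real^'n"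
    and p \<Phi> :: "real \<Rightarrow> real^'n"
    and u :: "real^'n \<Rightarrow> real \<Rightarrow> real^'n"
  assumes Q: "reversible_generator Q \<pi>"
    and \<omega>: "\<omega> = weight Q \<pi>"
    and \<theta>: "activation \<theta>"
    and L: "lagrangian (edges \<omega>) L"
    and H: "\<forall>(i, j)\<in>edges \<omega>. locally_Lipschitz (deriv (hamiltonian L i j))"
    and F: "C1_on prob_simplex orthant F"
    and G: "C1_on prob_simplex orthant G"
    and t: "t \<le> T"
    and p0: "p0 \<in> prob_simplex"
    and mfg: "mfg_solution \<omega> \<pi> \<theta> L F G t T p0 p \<Phi>"
    and master: "master_solution \<omega> \<pi> \<theta> L F G T u"
  shows "\<forall>s\<in>{t..T}. \<forall>i. \<Phi> s $ i = u (p s) s $ i"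
proof -
  let ?I = "{t..T}" and ?E = "edges \<omega>"
  let ?H = "\<lambda>x i j. hamiltonian L i j (dgrad \<omega> x i j)"
    and ?H' = "\<lambda>x i j. deriv (hamiltonian L i j) (dgrad \<omega> x i j)"
    and ?a = "\<lambda>s i j. act \<theta> \<pi> i j (p s)"
    and ?a' = "\<lambda>s i j. pd (act \<theta> \<pi> i j) i (p s)"
    and ?u' = "\<lambda>s i k. pd (\<lambda>q. u q s $ i) k (p s)"
  define v where "v s = u (p s) s" for s
  define w where "w s = \<Phi> s - v s" for s
  define p' where "p' s = (\<chi> i. - (\<Sum>j\<in>nbrs \<omega> i. sqrt (\<omega> i j) * ?a s i j * ?H' (\<Phi> s) i j))" for s
  define \<Phi>' where "\<Phi>' s = (\<chi> i. - ((\<Sum>j\<in>nbrs \<omega> i. ?H (\<Phi> s) i j * ?a' s i j) + F (p s) $ i))" for s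
  have pos: "0 < \<pi> $ i" for i
    using Q by (simp add: reversible_generator_def)
  have sym: "(j, i) \<in> ?E \<and> \<omega> i j = \<omega> j i" if "(i, j) \<in> ?E" for i j
    using edges_weight_sym[OF Q] that unfolding \<omega> by blast
  have p: "p s \<in> prob_simplex" if "s \<in> ?I" for s
    using mfg that by (simp add: mfg_solution_def)
  have Dp: "(p has_vector_derivative p' s) (at s within ?I)"
    and D\<Phi>: "(\<Phi> has_vector_derivative \<Phi>' s) (at s within ?I)" if "s \<in> ?I" for s
    using mfg that by (auto intro!: has_vector_derivative_cart simp: mfg_solution_def p'_def \<Phi>'_def)

  obtain D :: "(real^'n) \<times> real \<Rightarrow> ((real^'n) \<times> real) \<Rightarrow>\<^sub>L (real^'n)" where
    D: "\<And>z. z \<in> prob_simplex \<times> {..T} \<Longrightarrow>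
        ((\<lambda>(p, t). u p t) has_derivative D z) (at z within orthant \<times> {..T})"
    and contD: "continuous_on (prob_simplex \<times> {..T}) D"
    using master unfolding master_solution_def C1_on_def by blast
  have Du: "((\<lambda>(p, t). u p t) has_derivative D (p s, s)) (at (p s, s) within orthant \<times> {..T})"
    and orth: "p s \<in> orthant" and le: "s \<le> T" if "s \<in> ?I" for s
    using D[of "(p s, s)"] p[OF that] that prob_simplex_subset_orthant by auto
  have Dv: "(v has_vector_derivative D (p s, s) (p' s, 1)) (at s within ?I)" if "s \<in> ?I" for s
  proof -
    have "((\<lambda>r. (p r, r)) has_derivative (\<lambda>h. h *\<^sub>R (p' s, 1))) (at s within ?I)"
      using Dp[OF that] by (auto simp: has_vector_derivative_def intro!: derivative_eq_intros)
    then have "((\<lambda>r. case (p r, r) of (p, t) \<Rightarrow> u p t) has_derivative (\<lambda>h. D (p s, s) (h *\<^sub>R (p' s, 1))))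
        (at s within ?I)"
      by (rule has_derivative_compose_into[where f = "\<lambda>r. (p r, r)", OF _ _ Du[OF that]]) (use orth in auto)
    then show ?thesis
      unfolding has_vector_derivative_def v_def by (simp only: prod.case blinfun.scaleR_right)
  qed
  have contp: "continuous_on ?I p" and cont\<Phi>: "continuous_on ?I \<Phi>" and contv: "continuous_on ?I v"
    by (rule continuous_on_vector_derivative, erule Dp D\<Phi> Dv)+

  define A where "A i s = (\<Sum>j\<in>nbrs \<omega> i. (?H (\<Phi> s) i j - ?H (v s) i j) * ?a' s i j)" for i s
  define B where "B i s = (\<Sum>(j, k)\<in>?E. (?H' (\<Phi> s) j k - ?H' (v s) j k) * ?a s j k
      * dgrad_pd \<omega> (\<lambda>q. u q s $ i) (p s) j k)" for i s
  \<comment> \<open>The master equation replaces \<open>\<partial>\<^sub>t u\<close>, and \<open>F\<close> cancels.\<close>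
  have w': "(\<Phi>' s - D (p s, s) (p' s, 1)) $ i
      = - (A i s + 1 / 2 * B i s)"
    if s: "s \<in> ?I" for s i
  proof -
    let ?m = "\<lambda>j k. ?a s j k * ?H' (\<Phi> s) j k"
    have anti: "?m k j = - ?m j k" if "(j, k) \<in> ?E" for j k
      using hamiltonian_deriv_antisym[OF L that conjunct2[OF sym[OF that]], of "\<Phi> s"]
        act_sym[OF \<theta> pos p[OF s], of k j] by simp
    have "(\<Sum>k\<in>UNIV. p' s $ k * ?u' s i k)
        = (\<Sum>k\<in>UNIV. - (\<Sum>j\<in>nbrs \<omega> k. sqrt (\<omega> k j) * ?m k j) * (\<chi> k. ?u' s i k) $ k)"
      by (simp add: p'_def mult.assoc)
    also have "\<dots> = 1 / 2 * (\<Sum>(j, k)\<in>?E. ?m j k * dgrad_pd \<omega> (\<lambda>q. u q s $ i) (p s) j k)"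
      unfolding dgrad_pd_eq_dgrad by (rule discrete_integration_by_parts[OF sym anti])
    finally have "(\<Sum>k\<in>UNIV. p' s $ k * ?u' s i k)
        = 1 / 2 * (\<Sum>(j, k)\<in>?E. ?m j k * dgrad_pd \<omega> (\<lambda>q. u q s $ i) (p s) j k)" .
    moreover have "vector_derivative (\<lambda>\<tau>. u (p s) \<tau> $ i) (at s within {..T}) +
        (\<Sum>j\<in>nbrs \<omega> i. ?H (v s) i j * ?a' s i j) + F (p s) $ i +
        1 / 2 * (\<Sum>(j, k)\<in>?E. ?H' (v s) j k * dgrad_pd \<omega> (\<lambda>q. u q s $ i) (p s) j k * ?a s j k) = 0"
      using master p[OF s] le[OF s] unfolding master_solution_def v_def by blast
    moreover have "D (p s, s) (p' s, 1) $ i = vector_derivative (\<lambda>\<tau>. u (p s) \<tau> $ i) (at s within {..T})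
        + (\<Sum>k\<in>UNIV. p' s $ k * ?u' s i k)"
      by (rule total_derivative[OF Du[OF s] orth[OF s] le[OF s]])
    moreover have "B i s
        = (\<Sum>(j, k)\<in>?E. ?m j k * dgrad_pd \<omega> (\<lambda>q. u q s $ i) (p s) j k)
        - (\<Sum>(j, k)\<in>?E. ?H' (v s) j k * dgrad_pd \<omega> (\<lambda>q. u q s $ i) (p s) j k * ?a s j k)"
      unfolding B_def sum_subtractf[symmetric] by (intro sum.cong) (auto simp: algebra_simps)
    moreover have "A i s
        = (\<Sum>j\<in>nbrs \<omega> i. ?H (\<Phi> s) i j * ?a' s i j) - (\<Sum>j\<in>nbrs \<omega> i. ?H (v s) i j * ?a' s i j)"
      by (simp add: A_def left_diff_distrib sum_subtractf)
    ultimately show ?thesis by (simp add: \<Phi>'_def algebra_simps)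
  qed

  have bnd_a: "bounded ((\<lambda>s. ?a s i j) ` ?I)" for i j
    by (rule bounded_subset[OF bounded_act_pd_act(1)[OF \<theta> pos]]) (use p in auto)
  have bnd_a': "bounded ((\<lambda>s. ?a' s i j) ` ?I)" for i j
    by (rule bounded_subset[OF bounded_act_pd_act(2)[OF \<theta> pos]]) (use p in auto)
  have bnd_u': "bounded ((\<lambda>s. dgrad_pd \<omega> (\<lambda>q. u q s $ i) (p s) j k) ` ?I)" for i j k
  proof -
    have "continuous_on ?I (\<lambda>s. D (p s, s))"
      by (rule continuous_on_compose2[OF contD]) (use p contp in \<open>auto intro!: continuous_intros\<close>)
    then have "continuous_on ?I (\<lambda>s. ?u' s i k)" for k
      by (subst continuous_on_cong[OF refl partial_space[OF Du orth le]])
         (auto intro!: continuous_intros)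
    then show ?thesis
      unfolding dgrad_pd_def by (intro bounded_continuous_image continuous_intros) auto
  qed
  have lip': "locally_Lipschitz (deriv (hamiltonian L i j))" if "(i, j) \<in> ?E" for i j
    using H that by blast
  have lip: "locally_Lipschitz (hamiltonian L i j)" if "(i, j) \<in> ?E" for i j
  proof (rule locally_Lipschitz_antiderivative[OF _ lip'[OF that]])
    have "strictly_convex (L i j)" "superlinear (L i j)"
      using L that unfolding lagrangian_def by blast+
    then show "hamiltonian L i j field_differentiable at b" for b
      unfolding hamiltonian_eq_conjugate by (rule conjugate_differentiable)
  qed
  have A: "A i \<in> O[principal ?I](\<lambda>s. norm (w s))" for i
    unfolding A_def w_def
    by (intro big_sum_in_bigo bigo_mult_bounded bigo_dgrad_Lipschitz bnd_a' cont\<Phi> contv lip)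
       (simp add: nbrs_def)
  have B: "B i \<in> O[principal ?I](\<lambda>s. norm (w s))" for i
    unfolding B_def w_def case_prod_unfold
    by (intro big_sum_in_bigo bigo_mult_bounded bigo_dgrad_Lipschitz bnd_a bnd_u' cont\<Phi> contv lip')
       simp
  have "(\<lambda>s. (\<Phi>' s - D (p s, s) (p' s, 1)) $ i) \<in> O[principal ?I](\<lambda>s. norm (w s))" for i
  proof -
    have "(\<lambda>s. - (A i s + 1 / 2 * B i s)) \<in> O[principal ?I](\<lambda>s. norm (w s))"
      unfolding landau_o.big.uminus_in_iff by (intro sum_in_bigo) (use A B in simp_all)
    then show ?thesis
      by (rule landau_o.big.in_cong[THEN iffD1, rotated])
         (use w' in \<open>simp add: eventually_principal\<close>)
  qed
  then have bigo: "(\<lambda>s. norm (\<Phi>' s - D (p s, s) (p' s, 1))) \<in> O[principal ?I](\<lambda>s. norm (w s))"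
    by (rule norm_vec_bigo)
  have "w T = 0"
    using mfg master p[of T] t by (simp add: w_def v_def vec_eq_iff mfg_solution_def master_solution_def)
  moreover have "(w has_vector_derivative \<Phi>' s - D (p s, s) (p' s, 1)) (at s within ?I)" if "s \<in> ?I" for s
    unfolding w_def using D\<Phi>[OF that] Dv[OF that] by (rule has_vector_derivative_diff)
  ultimately have "w s = 0" if "s \<in> ?I" for s
    using backward_Gronwall_zero[OF _ bigo] that by blast
  then show ?thesis by (simp add: w_def v_def)
qed

end
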